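(* Let $n\ge 6$, let $\Lambda$ be an $n\times n$ linking matrix, and let $\mathcal{M}(\Lambda)$ be the resulting total Milnor quotient. Then $$\operatorname{rank}(\mathcal{M}(\Lambda))\ \ge\ \frac{n^3-9n^2+20n-6}{6},$$ where rank denotes the rank of a finitely generated abelian group.
   Context: A linking matrix is a symmetric $n\times n$ matrix $\Lambda=(\Lambda_{ij})$ with integer entries and zeros on the main diagonal. Let $e_1,\dots,e_n$ be the standard basis of $\mathbb{Z}^n$ and, for $1\le i,j,k\le n$, put $X^{ijk}=e_i\wedge e_j\wedge e_k\in \mathbb{Z}^n\wedge\mathbb{Z}^n\wedge\mathbb{Z}^n$ (third exterior power). Thus $X^{ijk}=0$ if two of the indices coincide, $X^{ijk}=X^{jki}=X^{kij}=-X^{ikj}=-X^{jik}=-X^{kji}$, and $\{X^{ijk}:1\le i<j<k\le n\}$ is a basis, giving an identification with $\mathbb{Z}^{\binom n3}$. For $1\le j\ne k\le n$ let $v_{jk}=\sum_{i=1}^n \Lambda_{ik}X^{ijk}$, and let $V(\Lambda)\subseteq\mathbb{Z}^{\binom n3}$ be the subgroup generated by all $v_{jk}$, $1\le j\neq k\le n$. The total Milnor quotient associated with $\Lambda$ is the abelian group $\mathcal{M}(\Lambda)=\mathbb{Z}^{\binom n3}/V(\Lambda)$. *)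

theory Defs
  imports Complex_Main "HOL-Algebra.Generated_Groups" "HOL-Algebra.Free_Abelian_Groups"
begin

section \<open>Linking matrices\<close>

text \<open>An \<open>n \<times> n\<close> matrix is a function of two indices in \<open>{1..n}\<close>; values outside this range
  are never used.\<close>

definition linking_matrix :: "nat \<Rightarrow> (nat \<Rightarrow> nat \<Rightarrow> int) \<Rightarrow> bool" where
  "linking_matrix n \<Lambda> \<longleftrightarrow>
     (\<forall>i\<in>{1..n}. \<forall>j\<in>{1..n}. \<Lambda> i j = \<Lambda> j i) \<and> (\<forall>i\<in>{1..n}. \<Lambda> i i = 0)"


section \<open>The third exterior power of \<open>\<int>\<^sup>n\<close>\<close>

definition triples :: "nat \<Rightarrow> (nat \<times> nat \<times> nat) set" where
  "triples n = {(i, j, k). 1 \<le> i \<and> i < j \<and> j < k \<and> k \<le> n}"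

text \<open>The third exterior power, identified with the free abelian group of rank \<open>n choose 3\<close> on
  the increasing triples; \<open>(i, j, k)\<close> stands for the basis vector \<open>e\<^sub>i \<and> e\<^sub>j \<and> e\<^sub>k\<close>.\<close>

definition ext3 :: "nat \<Rightarrow> ((nat \<times> nat \<times> nat) \<Rightarrow>\<^sub>0 int) monoid" where
  "ext3 n = free_Abelian_group (triples n)"

text \<open>\<open>minor3 u v w (a, b, c)\<close> is the determinant of the columns \<open>a, b, c\<close> of the matrix with rows
  \<open>u, v, w\<close>, i.e. the coefficient of \<open>u \<and> v \<and> w\<close> at \<open>e\<^sub>a \<and> e\<^sub>b \<and> e\<^sub>c\<close>.\<close>

fun minor3 :: "(nat \<Rightarrow> int) \<Rightarrow> (nat \<Rightarrow> int) \<Rightarrow> (nat \<Rightarrow> int) \<Rightarrow> nat \<times> nat \<times> nat \<Rightarrow> int" where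
  "minor3 u v w (a, b, c) =
     u a * (v b * w c - v c * w b) - u b * (v a * w c - v c * w a) + u c * (v a * w b - v b * w a)"

definition wedge3 ::
    "nat \<Rightarrow> (nat \<Rightarrow> int) \<Rightarrow> (nat \<Rightarrow> int) \<Rightarrow> (nat \<Rightarrow> int) \<Rightarrow> (nat \<times> nat \<times> nat) \<Rightarrow>\<^sub>0 int" where
  "wedge3 n u v w = (\<Sum>t\<in>triples n. frag_cmul (minor3 u v w t) (frag_of t))"

definition std_basis :: "nat \<Rightarrow> nat \<Rightarrow> int" where
  "std_basis i = (\<lambda>a. if a = i then 1 else 0)"

definition X3 :: "nat \<Rightarrow> nat \<Rightarrow> nat \<Rightarrow> nat \<Rightarrow> (nat \<times> nat \<times> nat) \<Rightarrow>\<^sub>0 int" where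
  "X3 n i j k = wedge3 n (std_basis i) (std_basis j) (std_basis k)"

lemma finite_triples: "finite (triples n)"
  by (rule finite_subset[of _ "{1..n} \<times> {1..n} \<times> {1..n}"]) (auto simp: triples_def)

lemma wedge3_closed: "wedge3 n u v w \<in> carrier (ext3 n)"
  unfolding wedge3_def ext3_def
  by (intro sum_closed_free_Abelian_group)
     (auto intro: subset_trans[OF keys_cmul])

lemma X3_closed: "X3 n i j k \<in> carrier (ext3 n)"
  by (simp add: X3_def wedge3_closed)

lemma X3_basis:
  assumes "(i, j, k) \<in> triples n"
  shows "X3 n i j k = frag_of (i, j, k)"
proof -
  have "minor3 (std_basis i) (std_basis j) (std_basis k) t = (if t = (i, j, k) then 1 else 0)"
    if "t \<in> triples n" for t
    using assms that by (cases t) (auto simp: triples_def std_basis_def)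
  then have "X3 n i j k = (\<Sum>t\<in>triples n. if t = (i, j, k) then frag_of t else 0)"
    unfolding X3_def wedge3_def by (intro sum.cong) auto
  then show ?thesis
    using assms by (simp add: finite_triples)
qed

lemma X3_swap12: "X3 n j i k = - X3 n i j k"
proof -
  have minor: "minor3 v u w t = - minor3 u v w t" for v u w :: "nat \<Rightarrow> int" and t
    by (cases t) (simp add: algebra_simps)
  show ?thesis
    by (simp add: X3_def wedge3_def minor[of "std_basis j" "std_basis i"] flip: sum_negf)
qed

lemma X3_swap23: "X3 n i k j = - X3 n i j k"
proof -
  have minor: "minor3 u w v t = - minor3 u v w t" for u w v :: "nat \<Rightarrow> int" and t
    by (cases t) (simp add: algebra_simps)
  show ?thesis
    by (simp add: X3_def wedge3_def minor[of "std_basis i" "std_basis k"] flip: sum_negf)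
qed

lemma X3_eq_0: "i = j \<or> j = k \<or> i = k \<Longrightarrow> X3 n i j k = 0"
proof -
  have "minor3 u v w t = 0" if "u = v \<or> v = w \<or> u = w" for u v w :: "nat \<Rightarrow> int" and t
    using that by (cases t) (auto simp: algebra_simps)
  then show "i = j \<or> j = k \<or> i = k \<Longrightarrow> X3 n i j k = 0"
    unfolding X3_def wedge3_def by (intro sum.neutral) auto
qed


section \<open>The total Milnor quotient\<close>

definition milnor_vec ::
    "nat \<Rightarrow> (nat \<Rightarrow> nat \<Rightarrow> int) \<Rightarrow> nat \<Rightarrow> nat \<Rightarrow> (nat \<times> nat \<times> nat) \<Rightarrow>\<^sub>0 int" where
  "milnor_vec n \<Lambda> j k = (\<Sum>i=1..n. frag_cmul (\<Lambda> i k) (X3 n i j k))"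

definition milnor_subgroup ::
    "nat \<Rightarrow> (nat \<Rightarrow> nat \<Rightarrow> int) \<Rightarrow> ((nat \<times> nat \<times> nat) \<Rightarrow>\<^sub>0 int) set" where
  "milnor_subgroup n \<Lambda> =
     generate (ext3 n) {milnor_vec n \<Lambda> j k | j k. j \<in> {1..n} \<and> k \<in> {1..n} \<and> j \<noteq> k}"

definition milnor_quotient ::
    "nat \<Rightarrow> (nat \<Rightarrow> nat \<Rightarrow> int) \<Rightarrow> ((nat \<times> nat \<times> nat) \<Rightarrow>\<^sub>0 int) set monoid" where
  "milnor_quotient n \<Lambda> = ext3 n Mod milnor_subgroup n \<Lambda>"

lemma comm_group_ext3: "comm_group (ext3 n)"
  by (simp add: ext3_def abelian_free_Abelian_group)

lemma milnor_vec_closed: "milnor_vec n \<Lambda> j k \<in> carrier (ext3 n)"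
  using X3_closed[of n _ j k] unfolding milnor_vec_def ext3_def
  by (intro sum_closed_free_Abelian_group)
     (metis (no_types) carrier_free_Abelian_group_iff keys_cmul subset_trans)

lemma subgroup_milnor_subgroup: "subgroup (milnor_subgroup n \<Lambda>) (ext3 n)"
  unfolding milnor_subgroup_def
  by (intro group.generate_is_subgroup comm_group.axioms(2) comm_group_ext3)
     (auto simp: milnor_vec_closed)

lemma comm_group_milnor_quotient: "comm_group (milnor_quotient n \<Lambda>)"
  unfolding milnor_quotient_def
  by (intro comm_group.abelian_FactGroup comm_group_ext3 subgroup_milnor_subgroup)


section \<open>Rank of a finitely generated abelian group\<close>

text \<open>The groups of the library are written multiplicatively, so an integral linear combination
  of the elements of \<open>S\<close> is a product of integer powers.\<close>

definition int_independent :: "('a, 'b) monoid_scheme \<Rightarrow> 'a set \<Rightarrow> bool" where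
  "int_independent G S \<longleftrightarrow> finite S \<and> S \<subseteq> carrier G \<and>
     (\<forall>c :: 'a \<Rightarrow> int. (\<Otimes>\<^bsub>G\<^esub>x\<in>S. x [^]\<^bsub>G\<^esub> c x) = \<one>\<^bsub>G\<^esub> \<longrightarrow> (\<forall>x\<in>S. c x = 0))"

text \<open>The supremum is a maximum for finitely generated \<open>G\<close>, where the size of an independent set
  is bounded by the number of generators; if the sizes are unbounded, the value is meaningless.\<close>

definition abelian_rank :: "('a, 'b) monoid_scheme \<Rightarrow> nat" where
  "abelian_rank G = Sup {card S | S. int_independent G S}"

end

theory Submission
  imports Defs "HOL-Library.Function_Algebras"
begin

text \<open>
  Since \<open>n choose 3\<close> exceeds the claimed bound by \<open>n\<^sup>2 - 3 n + 1 = n (n - 1) - (2 n - 1)\<close>, and \<open>V(\<Lambda>)\<close>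
  has \<open>n (n - 1)\<close> generators \<open>v\<^bsub>jk\<^esub>\<close>, it suffices that \<open>2 n - 1\<close> of these generators are rational
  combinations of the others.

  The symmetry of \<open>\<Lambda>\<close> and the antisymmetry of \<open>X\<^bsup>ijk\<^esup>\<close> yield two families of relations: for each row
  \<open>j\<close>, \<open>\<Sum>k. v\<^bsub>jk\<^esub> = 0\<close> (\<open>milnor_vec_row_sum\<close>), and for each column \<open>k\<close>, \<open>\<Sum>j. \<Lambda> j k v\<^bsub>jk\<^esub> = 0\<close>
  (\<open>milnor_vec_column_sum\<close>). These are \<open>2 n\<close> relations, and there can be a dependence among them:
  if all off-diagonal entries of \<open>\<Lambda>\<close> are \<open>1\<close>, the sum of the row relations is the sum of the column
  relations. Read \<open>\<Lambda>\<close> as a weighted graph. If it has no isolated vertex, the relations can always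
  be solved for \<open>2 n - 1\<close> generators (\<open>redundant_generators_no_isolated\<close>). If a vertex is isolated,
  its column relation is void, but the generators of that column vanish outright, and together with
  the row relations they again make \<open>2 n - 1\<close> generators redundant
  (\<open>redundant_generators_isolated\<close>).

  The passage from generators to the rank of the quotient is the exchange lemma over \<open>\<rat>\<close>: if a
  subgroup of a free abelian group lies in the rational span of \<open>q\<close> vectors, then all but at most \<open>q\<close>
  of the unit vectors can be chosen independent modulo it (\<open>abelian_rank_quotient_ge\<close>).
\<close>

section \<open>Integer vectors inside a rational vector space\<close>

text \<open>Ranks are computed over \<open>\<rat>\<close>. Functions \<open>'a \<Rightarrow> rat\<close> under pointwise operations form one
  vector space for all index sets, so that exchange arguments apply to the images of integer
  vectors without mentioning a dimension.\<close>

definition coords :: "('a \<Rightarrow>\<^sub>0 int) \<Rightarrow> 'a \<Rightarrow> rat" where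
  "coords x = (\<lambda>t. of_int (Poly_Mapping.lookup x t))"

definition scale_fun :: "rat \<Rightarrow> ('a \<Rightarrow> rat) \<Rightarrow> 'a \<Rightarrow> rat" where
  "scale_fun a f = (\<lambda>t. a * f t)"

interpretation ratfun: vector_space "scale_fun :: rat \<Rightarrow> ('a \<Rightarrow> rat) \<Rightarrow> 'a \<Rightarrow> rat"
  by unfold_locales (auto simp: scale_fun_def fun_eq_iff algebra_simps)

lemma sum_fun_apply: "(\<Sum>i\<in>I. f i) t = (\<Sum>i\<in>I. f i t :: rat)"
  by (induction I rule: infinite_finite_induct) auto

lemma coords_0 [simp]: "coords 0 = 0"
  by (simp add: coords_def fun_eq_iff)

lemma coords_add: "coords (x + y) = coords x + coords y"
  by (simp add: coords_def fun_eq_iff lookup_add)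

lemma coords_uminus: "coords (- x) = - coords x"
  by (simp add: coords_def fun_eq_iff)

lemma coords_frag_cmul: "coords (frag_cmul c x) = scale_fun (of_int c) (coords x)"
  by (simp add: coords_def scale_fun_def fun_eq_iff)

lemma coords_sum: "coords (\<Sum>i\<in>I. f i) = (\<Sum>i\<in>I. coords (f i))"
  by (induction I rule: infinite_finite_induct) (auto simp: coords_add)

lemma coords_eq_0_iff [simp]: "coords x = 0 \<longleftrightarrow> x = 0"
  by (auto simp: coords_def fun_eq_iff poly_mapping_eq_iff)

lemma coords_inject: "coords x = coords y \<longleftrightarrow> x = y"
  by (auto simp: coords_def fun_eq_iff poly_mapping_eq_iff)

lemma coords_frag_of: "coords (frag_of t) = (\<lambda>s. if s = t then 1 else 0)"
  by (auto simp: coords_def fun_eq_iff lookup_single when_def)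

lemma inj_coords_frag_of: "inj (\<lambda>t. coords (frag_of t))"
  by (auto simp: inj_def coords_frag_of fun_eq_iff split: if_splits)

lemma coords_in_span_frag_of:
  assumes "finite T" "x \<in> carrier (free_Abelian_group T)"
  shows "coords x \<in> ratfun.span ((\<lambda>t. coords (frag_of t)) ` T)"
proof -
  have "coords x = (\<Sum>t\<in>T. scale_fun (coords x t) (coords (frag_of t)))"
  proof
    fix s
    have "coords x s = 0" if "s \<notin> T"
      using assms that by (auto simp: coords_def in_keys_iff)
    with assms show "coords x s = (\<Sum>t\<in>T. scale_fun (coords x t) (coords (frag_of t))) s"
      by (auto simp: sum_fun_apply scale_fun_def coords_frag_of if_distrib cong: if_cong)
  qed
  then show ?thesis
    by (metis (no_types, lifting) imageI ratfun.span_base ratfun.span_scale ratfun.span_sum)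
qed

lemma independent_coords_frag_of:
  assumes "finite T"
  shows "ratfun.independent ((\<lambda>t. coords (frag_of t)) ` T)"
proof (rule ratfun.independent_if_scalars_zero)
  fix u and x :: "'a \<Rightarrow> rat"
  let ?e = "\<lambda>t. coords (frag_of t :: 'a \<Rightarrow>\<^sub>0 int)"
  assume 0: "(\<Sum>x\<in>?e ` T. scale_fun (u x) x) = 0" and "x \<in> ?e ` T"
  then obtain s where s: "s \<in> T" "x = ?e s" by blast
  have "(\<Sum>t\<in>T. scale_fun (u (?e t)) (?e t)) s = 0"
    using 0 by (subst (asm) sum.reindex) (auto intro: inj_on_subset[OF inj_coords_frag_of])
  then show "u x = 0"
    using s assms by (simp add: sum_fun_apply scale_fun_def coords_frag_of if_distrib cong: if_cong)
qed (use assms in auto)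

lemma coords_generate_in_span:
  assumes "H \<subseteq> carrier (free_Abelian_group T)"
    and "x \<in> generate (free_Abelian_group T) H"
  shows "coords x \<in> ratfun.span (coords ` H)"
  using assms(2)
proof (induction rule: generate.induct)
  case (inv h)
  with assms(1) have "h \<in> carrier (free_Abelian_group T)" by (rule subsetD)
  then have "Poly_Mapping.keys h \<subseteq> T" by simp
  then have "coords (inv\<^bsub>free_Abelian_group T\<^esub> h) = - coords h"
    by (simp only: inv_free_Abelian_group coords_uminus)
  with inv show ?case
    by (metis imageI ratfun.span_base ratfun.span_neg)
next
  case one
  show ?case
    unfolding one_free_Abelian_group coords_0 by (rule ratfun.span_zero)
next
  case (incl h)
  then show ?case by (simp add: ratfun.span_base)
next
  case (eng h1 h2)
  then show ?case
    unfolding mult_free_Abelian_group coords_add by (blast intro: ratfun.span_add)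
qed

text \<open>Turns a rational dependence into an integral one.\<close>

lemma common_denominator:
  assumes "finite S"
  shows "\<exists>d::int. d \<noteq> 0 \<and> (\<forall>x\<in>S. \<exists>c::int. of_int d * u x = (of_int c :: rat))"
  using assms
proof (induction S)
  case empty
  then show ?case by (auto intro: exI[of _ 1])
next
  case (insert y S)
  then obtain d where d: "d \<noteq> 0" "\<forall>x\<in>S. \<exists>c::int. of_int d * u x = of_int c" by blast
  obtain a b where ab: "u y = of_int a / of_int b" "b > 0"
    by (metis Fract_of_int_quotient Rat_cases)
  have "\<exists>c::int. of_int (d * b) * u x = of_int c" if x: "x \<in> insert y S" for x
  proof (cases "x = y")
    case True
    then show ?thesis using ab by (intro exI[of _ "d * a"]) simp
  next
    case False
    with x d obtain c :: int where "of_int d * u x = of_int c" by blast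
    then have "of_int (d * b) * u x = of_int (c * b)" by (simp add: algebra_simps)
    then show ?thesis by blast
  qed
  with d ab show ?case by (intro exI[of _ "d * b"]) auto
qed

section \<open>Independence in quotients of a free abelian group\<close>

lemma frag_sum_closed:
  assumes "\<And>i. i \<in> S \<Longrightarrow> f i \<in> carrier (free_Abelian_group T)"
  shows "(\<Sum>i\<in>S. frag_cmul (c i) (f i)) \<in> carrier (free_Abelian_group T)"
  using assms
  by (intro sum_closed_free_Abelian_group) (metis carrier_free_Abelian_group_iff keys_cmul subset_trans)

text \<open>The projection onto the quotient is a homomorphism, so a multiplicative integral combination
  of cosets, the form in which independence is defined, is the coset of the additive
  combination. Every question about the quotient thereby becomes one about membership in \<open>V\<close>.\<close>

lemma finprod_cosets:
  assumes "subgroup V (free_Abelian_group T)" "finite S"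
    and "\<And>i. i \<in> S \<Longrightarrow> f i \<in> carrier (free_Abelian_group T)"
  shows "(\<Otimes>\<^bsub>free_Abelian_group T Mod V\<^esub>i\<in>S. (V #>\<^bsub>free_Abelian_group T\<^esub> f i) [^]\<^bsub>free_Abelian_group T Mod V\<^esub> (c i :: int))
    = V #>\<^bsub>free_Abelian_group T\<^esub> (\<Sum>i\<in>S. frag_cmul (c i) (f i))"
proof -
  let ?F = "free_Abelian_group T"
  interpret F: comm_group ?F by (rule abelian_free_Abelian_group)
  interpret V: normal V ?F using assms(1) by (rule F.subgroup_imp_normal)
  interpret Q: comm_group "?F Mod V" using assms(1) by (rule F.abelian_FactGroup)
  have pow: "(V #>\<^bsub>?F\<^esub> x) [^]\<^bsub>?F Mod V\<^esub> k = V #>\<^bsub>?F\<^esub> frag_cmul k x"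
    if "x \<in> carrier ?F" for x and k :: int
  proof -
    have "(V #>\<^bsub>?F\<^esub> x) [^]\<^bsub>?F Mod V\<^esub> k = V #>\<^bsub>?F\<^esub> (x [^]\<^bsub>?F\<^esub> k)"
      using V.FactGroup_int_pow[of x k] that by simp
    then show ?thesis using that by simp
  qed
  show ?thesis
    using assms(2,3)
  proof (induction S)
    case empty
    have "V #>\<^bsub>?F\<^esub> 0 = V"
      using F.coset_mult_one[OF V.subset] by simp
    moreover have "\<one>\<^bsub>?F Mod V\<^esub> = V" by (simp add: FactGroup_def)
    ultimately show ?case by simp
  next
    case (insert j S)
    have cl: "V #>\<^bsub>?F\<^esub> frag_cmul (c i) (f i) \<in> carrier (?F Mod V)" if "i \<in> insert j S" for i
    proof -
      have "frag_cmul (c i) (f i) \<in> carrier ?F"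
        using insert.prems[OF that] by (auto intro: subset_trans[OF keys_cmul])
      then show ?thesis using F.rcosetsI[OF V.subset] by (simp add: FactGroup_def)
    qed
    have qc: "(V #>\<^bsub>?F\<^esub> f i) [^]\<^bsub>?F Mod V\<^esub> c i \<in> carrier (?F Mod V)" if "i \<in> insert j S" for i
      using cl[OF that] unfolding pow[OF insert.prems[OF that]] .
    have IH: "(\<Otimes>\<^bsub>?F Mod V\<^esub>i\<in>S. (V #>\<^bsub>?F\<^esub> f i) [^]\<^bsub>?F Mod V\<^esub> c i) = V #>\<^bsub>?F\<^esub> (\<Sum>i\<in>S. frag_cmul (c i) (f i))"
      by (rule insert.IH) (rule insert.prems, blast)
    have fin: "(\<Otimes>\<^bsub>?F Mod V\<^esub>i\<in>insert j S. (V #>\<^bsub>?F\<^esub> f i) [^]\<^bsub>?F Mod V\<^esub> c i) =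
      (V #>\<^bsub>?F\<^esub> frag_cmul (c j) (f j)) \<otimes>\<^bsub>?F Mod V\<^esub> (V #>\<^bsub>?F\<^esub> (\<Sum>i\<in>S. frag_cmul (c i) (f i)))"
      unfolding IH[symmetric] pow[OF insert.prems[OF insertI1], symmetric]
      by (rule Q.finprod_insert[OF insert.hyps]) (use qc in blast)+
    have a: "frag_cmul (c j) (f j) \<in> carrier ?F"
      using insert.prems[of j] by (auto intro: subset_trans[OF keys_cmul])
    have "(V #>\<^bsub>?F\<^esub> frag_cmul (c j) (f j)) \<otimes>\<^bsub>?F Mod V\<^esub> (V #>\<^bsub>?F\<^esub> (\<Sum>i\<in>S. frag_cmul (c i) (f i)))
      = V #>\<^bsub>?F\<^esub> (frag_cmul (c j) (f j) + (\<Sum>i\<in>S. frag_cmul (c i) (f i)))"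
      using V.rcos_sum[OF a frag_sum_closed[OF insert.prems[OF insertI2]]] by (simp add: FactGroup_def)
    with fin show ?case
      by (simp only: sum.insert[OF insert.hyps])
  qed
qed

lemma coset_eq_one_iff:
  assumes "subgroup V (free_Abelian_group T)" "x \<in> carrier (free_Abelian_group T)"
  shows "V #>\<^bsub>free_Abelian_group T\<^esub> x = \<one>\<^bsub>free_Abelian_group T Mod V\<^esub> \<longleftrightarrow> x \<in> V"
proof -
  interpret F: comm_group "free_Abelian_group T" by (rule abelian_free_Abelian_group)
  show ?thesis
    using assms F.coset_join1[OF _ assms(2,1)] F.coset_join2[OF assms(2,1)]
    by (auto simp: FactGroup_def)
qed

text \<open>Injectivity is the special case of the coefficients \<open>1\<close> and \<open>-1\<close>: if two cosets agree, the
  difference of their representatives is a combination that lies in \<open>V\<close>. It is needed to know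
  the number of cosets.\<close>

lemma int_independent_cosets:
  assumes V: "subgroup V (free_Abelian_group T)" and "finite I"
    and f: "\<And>i. i \<in> I \<Longrightarrow> f i \<in> carrier (free_Abelian_group T)"
    and ind: "\<And>c. (\<Sum>i\<in>I. frag_cmul (c i) (f i)) \<in> V \<Longrightarrow> \<forall>i\<in>I. c i = 0"
  shows "int_independent (free_Abelian_group T Mod V) ((\<lambda>i. V #>\<^bsub>free_Abelian_group T\<^esub> f i) ` I)"
    and "inj_on (\<lambda>i. V #>\<^bsub>free_Abelian_group T\<^esub> f i) I"
proof -
  let ?F = "free_Abelian_group T" and ?q = "\<lambda>i. V #>\<^bsub>free_Abelian_group T\<^esub> f i"
  interpret F: comm_group ?F by (rule abelian_free_Abelian_group)
  interpret Q: comm_group "?F Mod V" using V by (rule F.abelian_FactGroup)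
  show inj: "inj_on ?q I"
  proof (rule inj_onI, rule ccontr)
    fix i j assume ij: "i \<in> I" "j \<in> I" "?q i = ?q j" "i \<noteq> j"
    let ?c = "\<lambda>k. if k = i then 1 else if k = j then -1 else (0::int)"
    have "f i \<in> ?q j"
      using ij F.rcos_self[OF f[OF ij(1)] V] by simp
    then obtain h where h: "h \<in> V" "f i = h + f j"
      by (auto simp: r_coset_def)
    have "(\<Sum>k\<in>I. frag_cmul (?c k) (f k)) = (\<Sum>k\<in>{i,j}. frag_cmul (?c k) (f k))"
      using ij \<open>finite I\<close> by (intro sum.mono_neutral_right) auto
    also have "\<dots> = h" using ij h by simp
    finally show False using ind[of ?c] h(1) ij by auto
  qed
  have qcl: "?q i \<in> carrier (?F Mod V)" if "i \<in> I" for i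
    using F.rcosetsI[OF subgroup.subset[OF V] f[OF that]] by (simp add: FactGroup_def)
  have zero: "\<forall>x\<in>?q ` I. c x = 0"
    if "(\<Otimes>\<^bsub>?F Mod V\<^esub>x\<in>?q ` I. x [^]\<^bsub>?F Mod V\<^esub> c x) = \<one>\<^bsub>?F Mod V\<^esub>" for c :: "_ \<Rightarrow> int"
  proof -
    have "(\<Otimes>\<^bsub>?F Mod V\<^esub>i\<in>I. ?q i [^]\<^bsub>?F Mod V\<^esub> c (?q i)) = \<one>\<^bsub>?F Mod V\<^esub>"
    proof -
      have "(\<lambda>x. x [^]\<^bsub>?F Mod V\<^esub> c x) \<in> ?q ` I \<rightarrow> carrier (?F Mod V)"
        using qcl Q.int_pow_closed by blast
      from Q.finprod_reindex[OF this inj] that show ?thesis by (simp only:)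
    qed
    then have "V #>\<^bsub>?F\<^esub> (\<Sum>i\<in>I. frag_cmul (c (?q i)) (f i)) = \<one>\<^bsub>?F Mod V\<^esub>"
      by (subst finprod_cosets[OF V \<open>finite I\<close> f, symmetric])
    then have "(\<Sum>i\<in>I. frag_cmul (c (?q i)) (f i)) \<in> V"
      by (subst (asm) coset_eq_one_iff[OF V frag_sum_closed[OF f]])
    from ind[OF this] show ?thesis by auto
  qed
  show "int_independent (?F Mod V) (?q ` I)"
    unfolding int_independent_def using \<open>finite I\<close> qcl zero by blast
qed

text \<open>A rational dependence among representatives, multiplied by a common denominator, is an
  integral combination equal to \<open>0\<close>, which lies in \<open>V\<close>; so representatives of independent cosets
  are linearly independent over \<open>\<rat>\<close>. This bound makes the supremum in the definition of the rank
  a genuine one.\<close>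

lemma int_independent_card_le:
  assumes V: "subgroup V (free_Abelian_group T)" and "finite T"
    and S: "int_independent (free_Abelian_group T Mod V) S"
  shows "card S \<le> card T"
proof -
  let ?F = "free_Abelian_group T"
  interpret F: comm_group ?F by (rule abelian_free_Abelian_group)
  interpret Q: comm_group "?F Mod V" using V by (rule F.abelian_FactGroup)
  note S' = S[unfolded int_independent_def]
  have "finite S" using S' by (rule conjunct1)
  have carr: "S \<subseteq> carrier (?F Mod V)" using S'[THEN conjunct2] by (rule conjunct1)
  note S0 = S'[THEN conjunct2, THEN conjunct2, THEN spec, THEN mp]
  have "\<exists>y\<in>carrier ?F. x = V #>\<^bsub>?F\<^esub> y" if "x \<in> S" for x
    using subsetD[OF carr that] unfolding FactGroup_def RCOSETS_def by auto
  then have "\<forall>x\<in>S. \<exists>y. y \<in> carrier ?F \<and> V #>\<^bsub>?F\<^esub> y = x" by blast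
  from bchoice[OF this] obtain f where f: "\<And>x. x \<in> S \<Longrightarrow> f x \<in> carrier ?F"
    "\<And>x. x \<in> S \<Longrightarrow> V #>\<^bsub>?F\<^esub> f x = x"
    by blast
  have ind: "\<forall>x\<in>S. c x = 0" if "(\<Sum>x\<in>S. frag_cmul (c x) (f x)) = 0" for c
  proof -
    have "(\<Otimes>\<^bsub>?F Mod V\<^esub>x\<in>S. (V #>\<^bsub>?F\<^esub> f x) [^]\<^bsub>?F Mod V\<^esub> c x) = V #>\<^bsub>?F\<^esub> (\<Sum>x\<in>S. frag_cmul (c x) (f x))"
      by (rule finprod_cosets[OF V \<open>finite S\<close> f(1)])
    also have "\<dots> = \<one>\<^bsub>?F Mod V\<^esub>"
      unfolding that using coset_eq_one_iff[OF V, of 0] subgroup.one_closed[OF V] by simp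
    finally have one: "(\<Otimes>\<^bsub>?F Mod V\<^esub>x\<in>S. (V #>\<^bsub>?F\<^esub> f x) [^]\<^bsub>?F Mod V\<^esub> c x) = \<one>\<^bsub>?F Mod V\<^esub>" .
    have "(\<Otimes>\<^bsub>?F Mod V\<^esub>x\<in>S. (V #>\<^bsub>?F\<^esub> f x) [^]\<^bsub>?F Mod V\<^esub> c x) = (\<Otimes>\<^bsub>?F Mod V\<^esub>x\<in>S. x [^]\<^bsub>?F Mod V\<^esub> c x)"
    proof (rule Q.finprod_cong'[OF refl])
      show "(\<lambda>x. x [^]\<^bsub>?F Mod V\<^esub> c x) \<in> S \<rightarrow> carrier (?F Mod V)"
        using carr Q.int_pow_closed by blast
    qed (simp only: f(2))
    then have "(\<Otimes>\<^bsub>?F Mod V\<^esub>x\<in>S. x [^]\<^bsub>?F Mod V\<^esub> c x) = \<one>\<^bsub>?F Mod V\<^esub>"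
      using one by (rule trans[OF sym])
    from S0[OF this] show ?thesis by blast
  qed
  have inj: "inj_on (\<lambda>x. coords (f x)) S"
  proof (rule inj_onI)
    fix x y assume xy: "x \<in> S" "y \<in> S" "coords (f x) = coords (f y)"
    then have "f x = f y" by (simp only: coords_inject)
    then have "V #>\<^bsub>?F\<^esub> f x = V #>\<^bsub>?F\<^esub> f y" by (rule arg_cong)
    then show "x = y" unfolding f(2)[OF xy(1)] f(2)[OF xy(2)] .
  qed
  have "ratfun.independent ((\<lambda>x. coords (f x)) ` S)"
  proof (rule ratfun.independent_if_scalars_zero)
    fix u v assume 0: "(\<Sum>v\<in>(\<lambda>x. coords (f x)) ` S. scale_fun (u v) v) = 0"
      and "v \<in> (\<lambda>x. coords (f x)) ` S"
    then obtain x where x: "x \<in> S" "v = coords (f x)" by blast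
    obtain d :: int where d: "d \<noteq> 0"
        "\<forall>x\<in>S. \<exists>c::int. of_int d * u (coords (f x)) = of_int c"
      using common_denominator[OF \<open>finite S\<close>, of "\<lambda>x. u (coords (f x))"] by blast
    then obtain c :: "_ \<Rightarrow> int" where c: "\<And>x. x \<in> S \<Longrightarrow> of_int d * u (coords (f x)) = of_int (c x)"
      by metis
    have "coords (\<Sum>x\<in>S. frag_cmul (c x) (f x)) = (\<Sum>x\<in>S. scale_fun (of_int d) (scale_fun (u (coords (f x))) (coords (f x))))"
      unfolding coords_sum coords_frag_cmul by (intro sum.cong refl) (simp only: c ratfun.scale_scale)
    also have "\<dots> = scale_fun (of_int d) (\<Sum>x\<in>S. scale_fun (u (coords (f x))) (coords (f x)))"
      by (simp only: ratfun.scale_sum_right)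
    also have "\<dots> = 0"
      using 0 unfolding sum.reindex[OF inj] by (simp only: o_def ratfun.scale_zero_right)
    finally have "c x = 0" using ind x by simp
    with c[OF x(1)] have "of_int d * u v = 0" by (simp only: x(2) of_int_0)
    with d(1) show "u v = 0" by simp
  qed (use \<open>finite S\<close> in auto)
  moreover have "(\<lambda>x. coords (f x)) ` S \<subseteq> ratfun.span ((\<lambda>t. coords (frag_of t)) ` T)"
    using coords_in_span_frag_of[OF \<open>finite T\<close> f(1)] by (rule image_subsetI)
  ultimately have "card ((\<lambda>x. coords (f x)) ` S) \<le> card ((\<lambda>t. coords (frag_of t :: 'a \<Rightarrow>\<^sub>0 int)) ` T)"
    by (rule ratfun.independent_span_bound[OF finite_imageI[OF \<open>finite T\<close>], THEN conjunct2])
  also have "\<dots> \<le> card T" using \<open>finite T\<close> by (rule card_image_le)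
  finally show ?thesis using card_image[OF inj] by simp
qed

text \<open>Steinitz exchange: a basis \<open>B\<close> of the span of \<open>Q\<close>, extended by unit vectors to a basis \<open>C\<close> of
  a space that contains all unit vectors, needs at least \<open>card T - card B\<close> of them, and these
  remain independent modulo the span of \<open>B\<close>.\<close>

lemma basis_vectors_independent_mod_span:
  assumes "finite T" "finite Q"
  obtains S where "S \<subseteq> T" "card T \<le> card S + card Q"
    "\<And>c :: 'a \<Rightarrow> rat. (\<Sum>t\<in>S. scale_fun (c t) (coords (frag_of t))) \<in> ratfun.span Q \<Longrightarrow> \<forall>t\<in>S. c t = 0"
proof -
  let ?e = "\<lambda>t. coords (frag_of t :: 'a \<Rightarrow>\<^sub>0 int)"
  obtain B where B: "B \<subseteq> Q" "ratfun.independent B" "Q \<subseteq> ratfun.span B"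
    by (rule ratfun.maximal_independent_subset)
  obtain C where C: "B \<subseteq> C" "C \<subseteq> B \<union> ?e ` T" "ratfun.independent C" "B \<union> ?e ` T \<subseteq> ratfun.span C"
    using ratfun.maximal_independent_subset_extend[OF _ B(2)] by (metis Un_upper1)
  have fin: "finite B" "finite C"
    using B C assms by (meson finite_UnI finite_imageI finite_subset)+
  define S where "S = {t \<in> T. ?e t \<in> C - B}"
  have CB: "C - B = ?e ` S" using C(2) by (auto simp: S_def)
  have ST: "S \<subseteq> T" by (auto simp: S_def)
  have inj: "inj_on ?e A" for A by (rule inj_on_subset[OF inj_coords_frag_of]) simp
  have "card T = card (?e ` T)" using inj by (simp add: card_image)
  also have "\<dots> \<le> card C"
    using ratfun.independent_span_bound[OF fin(2) independent_coords_frag_of[OF assms(1)]] C(4) by blast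
  also have "\<dots> = card (C - B) + card B"
    using card_Diff_subset[OF fin(1) C(1)] card_mono[OF fin(2) C(1)] by simp
  also have "card (C - B) = card S" using inj CB by (simp add: card_image)
  also have "card B \<le> card Q" using B(1) assms(2) by (simp add: card_mono)
  finally have card: "card T \<le> card S + card Q" by simp
  have "\<forall>t\<in>S. c t = 0"
    if c: "(\<Sum>t\<in>S. scale_fun (c t) (?e t)) \<in> ratfun.span Q" for c :: "'a \<Rightarrow> rat"
  proof -
    have "ratfun.span Q \<subseteq> ratfun.span B"
      using B(3) by (simp add: ratfun.span_minimal)
    then have "(\<Sum>t\<in>S. scale_fun (c t) (?e t)) \<in> range (\<lambda>b. \<Sum>v\<in>B. scale_fun (b v) v)"
      using c unfolding ratfun.span_finite[OF fin(1)] by (rule subsetD)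
    then obtain b where b: "(\<Sum>t\<in>S. scale_fun (c t) (?e t)) = (\<Sum>v\<in>B. scale_fun (b v) v)"
      by (rule rangeE)
    \<comment> \<open>The difference of both sides, as a single combination of the basis \<open>C\<close>.\<close>
    define u where "u v = (if v \<in> B then - b v else c (the_inv_into S ?e v))" for v
    have "(\<Sum>v\<in>C. scale_fun (u v) v) = (\<Sum>v\<in>B. scale_fun (u v) v) + (\<Sum>v\<in>?e ` S. scale_fun (u v) v)"
      unfolding CB[symmetric] by (subst sum.subset_diff[OF C(1) fin(2)]) (rule add.commute)
    also have "(\<Sum>v\<in>B. scale_fun (u v) v) = - (\<Sum>v\<in>B. scale_fun (b v) v)"
      unfolding sum_negf[symmetric] by (intro sum.cong refl) (simp add: u_def)
    also have "(\<Sum>v\<in>?e ` S. scale_fun (u v) v) = (\<Sum>t\<in>S. scale_fun (c t) (?e t))"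
    proof -
      have "u (?e t) = c t" if "t \<in> S" for t
        using that by (simp add: u_def S_def the_inv_into_f_f[OF inj])
      then show ?thesis by (simp add: sum.reindex[OF inj])
    qed
    finally have "(\<Sum>v\<in>C. scale_fun (u v) v) = 0" unfolding b by (simp only: left_minus)
    then have "u (?e t) = 0" if "t \<in> S" for t
      using ratfun.independentD[OF C(3) fin(2) subset_refl] CB that by blast
    then show ?thesis by (auto simp: u_def S_def the_inv_into_f_f[OF inj] split: if_splits)
  qed
  with that ST card show thesis by blast
qed

text \<open>The link between the rank and linear algebra: a subgroup whose generators lie in the rational
  span of \<open>card Q\<close> vectors lowers the rank of the free group by at most \<open>card Q\<close>, however many
  generators there are.\<close>

lemma abelian_rank_quotient_ge:
  assumes "finite T" "finite Q" and H: "H \<subseteq> carrier (free_Abelian_group T)"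
    and span: "coords ` H \<subseteq> ratfun.span Q"
  shows "card T \<le> abelian_rank (free_Abelian_group T Mod generate (free_Abelian_group T) H) + card Q"
proof -
  let ?F = "free_Abelian_group T"
  let ?V = "generate ?F H"
  interpret F: comm_group ?F by (rule abelian_free_Abelian_group)
  have V: "subgroup ?V ?F" using H by (rule F.generate_is_subgroup)
  obtain S where S: "S \<subseteq> T" "card T \<le> card S + card Q"
    "\<And>c. (\<Sum>t\<in>S. scale_fun (c t) (coords (frag_of t :: 'a \<Rightarrow>\<^sub>0 int))) \<in> ratfun.span Q \<Longrightarrow> \<forall>t\<in>S. c t = 0"
    using basis_vectors_independent_mod_span[OF assms(1,2)] by metis
  have finS: "finite S" using S(1) assms(1) by (rule finite_subset)
  have ind: "\<forall>t\<in>S. c t = 0" if "(\<Sum>t\<in>S. frag_cmul (c t) (frag_of t)) \<in> ?V" for c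
  proof -
    have "coords (\<Sum>t\<in>S. frag_cmul (c t) (frag_of t)) \<in> ratfun.span Q"
      using coords_generate_in_span[OF H that] span ratfun.span_minimal ratfun.subspace_span by blast
    from S(3)[of "\<lambda>t. of_int (c t)"] this show ?thesis by (simp add: coords_sum coords_frag_cmul)
  qed
  let ?q = "\<lambda>t. ?V #>\<^bsub>?F\<^esub> frag_of t"
  have e: "frag_of t \<in> carrier ?F" if "t \<in> S" for t using S(1) that by auto
  note indq = int_independent_cosets[OF V finS e ind]
  have "card S = card (?q ` S)" using indq(2) by (simp add: card_image)
  also have "\<dots> \<le> abelian_rank (?F Mod ?V)"
    unfolding abelian_rank_def
  proof (rule cSup_upper)
    show "bdd_above {card S |S. int_independent (?F Mod ?V) S}"
      using int_independent_card_le[OF V assms(1)] by (auto intro!: bdd_aboveI)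
    show "card (?q ` S) \<in> {card S |S. int_independent (?F Mod ?V) S}"
      unfolding mem_Collect_eq using indq(1) by (intro exI[of _ "?q ` S"] conjI refl)
  qed
  finally show ?thesis using S(2) by simp
qed

section \<open>Relations among the generators of the Milnor subgroup\<close>

lemma antisymmetric_double_sum:
  fixes g :: "'b \<Rightarrow> 'b \<Rightarrow> 'a \<Rightarrow>\<^sub>0 int"
  assumes "\<And>i k. i \<in> A \<Longrightarrow> k \<in> A \<Longrightarrow> g k i = - g i k"
  shows "(\<Sum>i\<in>A. \<Sum>k\<in>A. g i k) = 0"
proof -
  have "(\<Sum>i\<in>A. \<Sum>k\<in>A. g i k) = (\<Sum>k\<in>A. \<Sum>i\<in>A. g i k)" by (rule sum.swap)
  also have "\<dots> = (\<Sum>k\<in>A. \<Sum>i\<in>A. - g k i)" by (intro sum.cong refl) (rule assms)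
  also have "\<dots> = - (\<Sum>i\<in>A. \<Sum>k\<in>A. g i k)" by (simp add: sum_negf)
  finally have eq: "(\<Sum>i\<in>A. \<Sum>k\<in>A. g i k) = - (\<Sum>i\<in>A. \<Sum>k\<in>A. g i k)" .
  have "x = 0" if "x = - x" for x :: "'a \<Rightarrow>\<^sub>0 int"
  proof (rule poly_mapping_eqI)
    fix t
    have "Poly_Mapping.lookup x t = Poly_Mapping.lookup (- x) t"
      by (rule arg_cong[OF that])
    then show "Poly_Mapping.lookup x t = Poly_Mapping.lookup 0 t"
      unfolding lookup_uminus by simp
  qed
  from this[OF eq] show ?thesis .
qed

lemma frag_cmul_uminus: "frag_cmul c (- x) = - frag_cmul c x"
  by (rule poly_mapping_eqI) simp

text \<open>The sum is \<open>\<Sum>i k. \<Lambda> i k X\<^bsup>ijk\<^esup>\<close>, where \<open>\<Lambda>\<close> is symmetric in \<open>i, k\<close> and \<open>X\<^bsup>ijk\<^esup>\<close> is antisymmetric.\<close>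

lemma milnor_vec_row_sum:
  assumes "linking_matrix n \<Lambda>"
  shows "(\<Sum>k=1..n. milnor_vec n \<Lambda> j k) = 0"
  unfolding milnor_vec_def
proof (rule antisymmetric_double_sum)
  fix i k assume "i \<in> {1..n}" "k \<in> {1..n}"
  then have "\<Lambda> k i = \<Lambda> i k" using assms by (simp add: linking_matrix_def)
  moreover have "X3 n k j i = - X3 n i j k"
    using X3_swap12[of n k j i] X3_swap23[of n j k i] X3_swap12[of n j i k] by simp
  ultimately show "frag_cmul (\<Lambda> k i) (X3 n k j i) = - frag_cmul (\<Lambda> i k) (X3 n i j k)"
    by (simp only: frag_cmul_uminus)
qed

text \<open>The sum is \<open>\<Sum>i j. \<Lambda> i k \<Lambda> j k X\<^bsup>ijk\<^esup>\<close>, where the coefficient is symmetric in \<open>i, j\<close> and \<open>X\<^bsup>ijk\<^esup>\<close> is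
  antisymmetric.\<close>

lemma milnor_vec_column_sum: "(\<Sum>j=1..n. frag_cmul (\<Lambda> j k) (milnor_vec n \<Lambda> j k)) = 0"
  unfolding milnor_vec_def frag_cmul_sum
proof (rule antisymmetric_double_sum)
  fix i j
  show "frag_cmul (\<Lambda> j k) (frag_cmul (\<Lambda> i k) (X3 n i j k)) =
    - frag_cmul (\<Lambda> i k) (frag_cmul (\<Lambda> j k) (X3 n j i k))"
    unfolding X3_swap12[of n j i k] by (simp add: frag_cmul_uminus mult.commute)
qed

lemma milnor_vec_diagonal: "milnor_vec n \<Lambda> j j = 0"
  unfolding milnor_vec_def by (intro sum.neutral) (simp add: X3_eq_0)

text \<open>Solves an integral relation for one of its members, which is where rational coefficients are
  indispensable: \<open>a i0\<close> need not be a unit.\<close>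

lemma in_span_of_relation:
  assumes rel: "(\<Sum>i\<in>I. frag_cmul (a i) (f i)) = 0" and "finite I" "i0 \<in> I" "a i0 \<noteq> 0"
    and others: "\<And>i. i \<in> I \<Longrightarrow> i \<noteq> i0 \<Longrightarrow> a i = 0 \<or> coords (f i) \<in> ratfun.span Q"
  shows "coords (f i0) \<in> ratfun.span Q"
proof -
  have "scale_fun (of_int (a i0)) (coords (f i0)) + (\<Sum>i\<in>I - {i0}. scale_fun (of_int (a i)) (coords (f i))) = 0"
    using arg_cong[OF rel, of coords] sum.remove[OF assms(2,3), of "\<lambda>i. scale_fun (of_int (a i)) (coords (f i))"]
    unfolding coords_sum coords_frag_cmul coords_0 by (simp only:)
  then have "scale_fun (of_int (a i0)) (coords (f i0)) = - (\<Sum>i\<in>I - {i0}. scale_fun (of_int (a i)) (coords (f i)))"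
    by (simp only: eq_neg_iff_add_eq_0)
  moreover have "- (\<Sum>i\<in>I - {i0}. scale_fun (of_int (a i)) (coords (f i))) \<in> ratfun.span Q"
  proof (intro ratfun.span_neg ratfun.span_sum)
    fix i assume i: "i \<in> I - {i0}"
    show "scale_fun (of_int (a i)) (coords (f i)) \<in> ratfun.span Q"
    proof (cases "a i = 0")
      case True
      show ?thesis unfolding True of_int_0 ratfun.scale_zero_left by (rule ratfun.span_zero)
    next
      case False
      with i others[of i] show ?thesis by (intro ratfun.span_scale) blast
    qed
  qed
  ultimately have *: "scale_fun (of_int (a i0)) (coords (f i0)) \<in> ratfun.span Q" by (simp only:)
  have "scale_fun (inverse (of_int (a i0))) (scale_fun (of_int (a i0)) (coords (f i0))) = coords (f i0)"
    using assms(4) by (simp add: scale_fun_def fun_eq_iff)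
  with ratfun.span_scale[OF *, of "inverse (of_int (a i0))"] show ?thesis by (simp only:)
qed

section \<open>Redundant generators\<close>

abbreviation off_diagonal :: "nat \<Rightarrow> (nat \<times> nat) set" where
  "off_diagonal n \<equiv> {(j, k). j \<in> {1..n} \<and> k \<in> {1..n} \<and> j \<noteq> k}"

abbreviation milnor_span ::
    "nat \<Rightarrow> (nat \<Rightarrow> nat \<Rightarrow> int) \<Rightarrow> (nat \<times> nat) set \<Rightarrow> (nat \<times> nat \<times> nat \<Rightarrow> rat) set" where
  "milnor_span n \<Lambda> P \<equiv> ratfun.span ((\<lambda>(j, k). coords (milnor_vec n \<Lambda> j k)) ` P)"

lemma card_off_diagonal: "card (off_diagonal n) = n * (n - 1)"
proof -
  have "off_diagonal n = Sigma {1..n} (\<lambda>j. {1..n} - {j})" by auto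
  then show ?thesis by simp
qed

text \<open>If column \<open>i0\<close> vanishes, the \<open>n - 1\<close> vectors \<open>v\<^bsub>j i0\<^esub>\<close> are zero, and each of the \<open>n\<close> row relations
  expresses one further vector \<open>v\<^bsub>j \<kappa>(j)\<^esub>\<close> of its row by the rest of the row.\<close>

lemma redundant_generators_isolated:
  assumes L: "linking_matrix n \<Lambda>" and n: "n \<ge> 3" and i0: "i0 \<in> {1..n}"
    and iso: "\<And>i. i \<in> {1..n} \<Longrightarrow> \<Lambda> i i0 = 0"
  obtains E where "E \<subseteq> off_diagonal n" "card E = 2 * n - 1"
    "\<And>j k. j \<in> {1..n} \<Longrightarrow> k \<in> {1..n} \<Longrightarrow> coords (milnor_vec n \<Lambda> j k) \<in>
       milnor_span n \<Lambda> (off_diagonal n - E)"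
proof -
  have "\<exists>k. k \<in> {1..n} \<and> k \<noteq> j \<and> k \<noteq> i0" for j
  proof -
    have "{1..n} - {j, i0} \<noteq> {}"
    proof
      assume "{1..n} - {j, i0} = {}"
      then have "card {1..n} \<le> card {j, i0}" by (intro card_mono) auto
      then show False using n by (simp add: card_insert_if split: if_splits)
    qed
    then show ?thesis by auto
  qed
  then obtain \<kappa> where \<kappa>: "\<And>j. \<kappa> j \<in> {1..n}" "\<And>j. \<kappa> j \<noteq> j" "\<And>j. \<kappa> j \<noteq> i0" by metis
  define E where "E = (\<lambda>j. (j, i0)) ` ({1..n} - {i0}) \<union> (\<lambda>j. (j, \<kappa> j)) ` {1..n}"
  have sub: "E \<subseteq> off_diagonal n" using i0 \<kappa>(1) \<kappa>(2)[symmetric] by (auto simp: E_def)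
  have "card E = card ((\<lambda>j. (j, i0)) ` ({1..n} - {i0})) + card ((\<lambda>j. (j, \<kappa> j)) ` {1..n})"
    unfolding E_def using \<kappa>(3) by (intro card_Un_disjoint) auto
  then have card: "card E = 2 * n - 1"
    using i0 n by (simp add: card_image inj_on_def)
  let ?v = "\<lambda>j k. coords (milnor_vec n \<Lambda> j k)"
  let ?W = "milnor_span n \<Lambda> (off_diagonal n - E)"
  have base: "?v j k \<in> ?W" if "(j, k) \<in> off_diagonal n" "(j, k) \<notin> E" for j k
    using that by (intro ratfun.span_base) (auto intro!: image_eqI[of _ _ "(j, k)"])
  have zero: "?v j k \<in> ?W" if "milnor_vec n \<Lambda> j k = 0" for j k
    unfolding that coords_0 by (rule ratfun.span_zero)
  have col: "?v j i0 \<in> ?W" for j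
  proof (rule zero)
    show "milnor_vec n \<Lambda> j i0 = 0"
      unfolding milnor_vec_def by (intro sum.neutral) (simp add: iso)
  qed
  have other: "?v j k \<in> ?W" if "j \<in> {1..n}" "k \<in> {1..n}" "k \<noteq> \<kappa> j" for j k
  proof -
    have "(j, k) \<notin> E" if "k \<noteq> i0"
      using that \<open>k \<noteq> \<kappa> j\<close> by (auto simp: E_def)
    then show ?thesis
      using that col[of j] zero[OF milnor_vec_diagonal, of j] base[of j k] by blast
  qed
  have forced: "?v j (\<kappa> j) \<in> ?W" if "j \<in> {1..n}" for j
  proof (rule in_span_of_relation[where I = "{1..n}" and a = "\<lambda>_. 1" and f = "milnor_vec n \<Lambda> j"])
    show "(\<Sum>k = 1..n. frag_cmul 1 (milnor_vec n \<Lambda> j k)) = 0"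
      using milnor_vec_row_sum[OF L] by simp
  qed (use \<kappa> that other in auto)
  have "?v j k \<in> ?W" if "j \<in> {1..n}" "k \<in> {1..n}" for j k
    using other[OF that] forced[OF that(1)] by (cases "k = \<kappa> j") simp_all
  with sub card show thesis by (rule that)
qed

text \<open>The redundant generators are \<open>v\<^bsub>j k0\<^esub>\<close> for \<open>j \<noteq> k0\<close>, then \<open>v\<^bsub>\<nu>(k) k\<^esub>\<close> for \<open>k \<noteq> k0\<close>, where \<open>\<nu>(k)\<close> is
  a neighbour of \<open>k\<close> (\<open>\<Lambda> (\<nu> k) k \<noteq> 0\<close>), and the single vector \<open>v\<^bsub>k0 l\<^esub>\<close>. These are \<open>2 n - 1\<close> distinct
  positions only if \<open>\<nu>(l) \<noteq> k0\<close>, so \<open>k0\<close> must not be the only neighbour of \<open>l\<close>. The relations are then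
  triangular: the columns \<open>k\<close> other than \<open>k0\<close> and \<open>l\<close> give \<open>v\<^bsub>\<nu>(k) k\<^esub>\<close>, next row \<open>k0\<close> gives \<open>v\<^bsub>k0 l\<^esub>\<close>, next
  column \<open>l\<close> gives \<open>v\<^bsub>\<nu>(l) l\<^esub>\<close>, and finally the remaining rows give the vectors \<open>v\<^bsub>j k0\<^esub>\<close>.\<close>

lemma redundant_generators_no_isolated:
  assumes L: "linking_matrix n \<Lambda>" and n: "n \<ge> 3"
    and nbr: "\<And>k. k \<in> {1..n} \<Longrightarrow> \<exists>i\<in>{1..n}. \<Lambda> i k \<noteq> 0"
  obtains E where "E \<subseteq> off_diagonal n" "card E = 2 * n - 1"
    "\<And>j k. j \<in> {1..n} \<Longrightarrow> k \<in> {1..n} \<Longrightarrow> coords (milnor_vec n \<Lambda> j k) \<in>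
       milnor_span n \<Lambda> (off_diagonal n - E)"
proof -
  have diag: "\<Lambda> i i = 0" if "i \<in> {1..n}" for i using L that by (auto simp: linking_matrix_def)
  \<comment> \<open>Take any edge \<open>l m\<close> of the graph of \<open>\<Lambda>\<close> and any third vertex \<open>k0\<close>.\<close>
  obtain k0 l m where klm: "k0 \<in> {1..n}" "l \<in> {1..n}" "m \<in> {1..n}" "l \<noteq> k0" "m \<noteq> k0" "\<Lambda> m l \<noteq> 0"
  proof -
    have one: "1 \<in> {1..n}" using n by simp
    with nbr obtain i where i: "i \<in> {1..n}" "\<Lambda> i 1 \<noteq> 0" by blast
    have "\<exists>k\<in>{1..n}. k \<noteq> 1 \<and> k \<noteq> i"
      using n by (intro bexI[of _ "if i = 2 then 3 else 2"]) auto
    then obtain k where "k \<in> {1..n}" "k \<noteq> 1" "k \<noteq> i" by blast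
    with one i show thesis by (intro that[of k 1 i]) auto
  qed
  have "\<forall>k\<in>{1..n}. \<exists>i. i \<in> {1..n} \<and> \<Lambda> i k \<noteq> 0" using nbr by blast
  from bchoice[OF this] obtain \<eta> where \<eta>: "\<And>k. k \<in> {1..n} \<Longrightarrow> \<eta> k \<in> {1..n} \<and> \<Lambda> (\<eta> k) k \<noteq> 0"
    by blast
  define \<nu> where "\<nu> = \<eta>(l := m)"
  have \<nu>: "\<nu> k \<in> {1..n} \<and> \<Lambda> (\<nu> k) k \<noteq> 0" if "k \<in> {1..n}" for k
    using klm \<eta>[OF that] by (simp add: \<nu>_def)
  have \<nu>_neq: "\<nu> k \<noteq> k" if "k \<in> {1..n}" for k using \<nu>[OF that] diag[OF that] by metis
  have \<nu>_l: "\<nu> l = m" by (simp add: \<nu>_def)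
  define E where "E = (\<lambda>j. (j, k0)) ` ({1..n} - {k0}) \<union> insert (k0, l) ((\<lambda>k. (\<nu> k, k)) ` ({1..n} - {k0}))"
  have sub: "E \<subseteq> off_diagonal n" using klm \<nu> \<nu>_neq by (auto simp: E_def)
  have "(k0, l) \<notin> (\<lambda>k. (\<nu> k, k)) ` ({1..n} - {k0})" using \<nu>_l klm by auto
  moreover have "card E = card ((\<lambda>j. (j, k0)) ` ({1..n} - {k0})) + card (insert (k0, l) ((\<lambda>k. (\<nu> k, k)) ` ({1..n} - {k0})))"
    unfolding E_def using klm by (intro card_Un_disjoint) auto
  ultimately have card: "card E = 2 * n - 1"
    using klm n by (simp add: card_image inj_on_def)
  let ?v = "\<lambda>j k. coords (milnor_vec n \<Lambda> j k)"
  let ?W = "milnor_span n \<Lambda> (off_diagonal n - E)"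
  have base: "?v j k \<in> ?W" if "(j, k) \<in> off_diagonal n" "(j, k) \<notin> E" for j k
    using that by (intro ratfun.span_base) (auto intro!: image_eqI[of _ _ "(j, k)"])
  have dia: "?v j j \<in> ?W" for j
    unfolding milnor_vec_diagonal coords_0 by (rule ratfun.span_zero)
  have free: "?v j k \<in> ?W" if "j \<in> {1..n}" "k \<in> {1..n}" "k \<noteq> k0" "j \<noteq> \<nu> k" "(j, k) \<noteq> (k0, l)" for j k
  proof (cases "j = k")
    case True
    then show ?thesis using dia by simp
  next
    case False
    then show ?thesis using that by (intro base) (auto simp: E_def)
  qed
  have column: "?v (\<nu> k) k \<in> ?W" if k: "k \<in> {1..n}" "k \<noteq> k0" and l: "k = l \<Longrightarrow> ?v k0 l \<in> ?W" for k
  proof (rule in_span_of_relation[where I = "{1..n}" and a = "\<lambda>j. \<Lambda> j k" and f = "\<lambda>j. milnor_vec n \<Lambda> j k"])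
    show "(\<Sum>j = 1..n. frag_cmul (\<Lambda> j k) (milnor_vec n \<Lambda> j k)) = 0"
      by (rule milnor_vec_column_sum)
    fix j assume "j \<in> {1..n}" "j \<noteq> \<nu> k"
    then show "\<Lambda> j k = 0 \<or> ?v j k \<in> ?W"
      using k l free[of j k] by (cases "(j, k) = (k0, l)") auto
  qed (use \<nu>[OF k(1)] in auto)
  have row: "?v j k1 \<in> ?W"
    if "j \<in> {1..n}" "k1 \<in> {1..n}" "\<And>k. k \<in> {1..n} \<Longrightarrow> k \<noteq> k1 \<Longrightarrow> ?v j k \<in> ?W" for j k1
  proof (rule in_span_of_relation[where I = "{1..n}" and a = "\<lambda>_. 1" and f = "milnor_vec n \<Lambda> j"])
    show "(\<Sum>k = 1..n. frag_cmul 1 (milnor_vec n \<Lambda> j k)) = 0"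
      using milnor_vec_row_sum[OF L] by simp
  qed (use that in auto)
  have k0l: "?v k0 l \<in> ?W"
  proof (rule row)
    fix k assume k: "k \<in> {1..n}" "k \<noteq> l"
    consider "k = k0" | "k \<noteq> k0" "k0 = \<nu> k" | "k \<noteq> k0" "k0 \<noteq> \<nu> k" by blast
    then show "?v k0 k \<in> ?W"
    proof cases
      case 2
      with column[of k] k show ?thesis by simp
    next
      case 3
      with free[of k0 k] k klm show ?thesis by simp
    qed (use dia in simp)
  qed (use klm in auto)
  have off: "?v j k \<in> ?W" if "j \<in> {1..n}" "k \<in> {1..n}" "k \<noteq> k0" for j k
  proof -
    consider "j = \<nu> k" | "(j, k) = (k0, l)" | "j \<noteq> \<nu> k" "(j, k) \<noteq> (k0, l)" by blast
    then show ?thesis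
      by cases (use column[OF that(2,3)] free[OF that] k0l in auto)
  qed
  have "?v j k \<in> ?W" if "j \<in> {1..n}" "k \<in> {1..n}" for j k
  proof (cases "k = k0")
    case True
    then show ?thesis using row[OF that(1) klm(1)] off that(1) by blast
  next
    case False
    then show ?thesis using off that by blast
  qed
  with sub card show thesis by (rule that)
qed

section \<open>The rank bound\<close>

lemma card_triples: "real (card (triples n)) = (real n ^ 3 - 3 * real n ^ 2 + 2 * real n) / 6"
proof (induction n)
  case 0
  have "triples 0 = {}" by (auto simp: triples_def)
  then show ?case by simp
next
  case (Suc n)
  \<comment> \<open>\<open>?Q\<close> indexes the triples whose largest entry is \<open>Suc n\<close>.\<close>
  let ?Q = "SIGMA j:{1..n}. {1..<j}"
  let ?f = "\<lambda>(j, i). (i, j, Suc n)"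
  have "triples (Suc n) = triples n \<union> ?f ` ?Q"
    by (auto simp: triples_def image_iff le_Suc_eq)
  moreover have "triples n \<inter> ?f ` ?Q = {}" by (auto simp: triples_def)
  moreover have "card (?f ` ?Q) = card ?Q" by (intro card_image) (auto simp: inj_on_def)
  ultimately have "card (triples (Suc n)) = card (triples n) + card ?Q"
    using finite_triples[of n] by (simp add: card_Un_disjoint)
  moreover have "real (card ?Q) = real n * (real n - 1) / 2"
    by (simp, induction n) (auto simp: field_simps)
  ultimately show ?case using Suc.IH by (simp add: field_simps power2_eq_square power3_eq_cube)
qed

theorem theorem1p2:
  fixes n :: nat and \<Lambda> :: "nat \<Rightarrow> nat \<Rightarrow> int"
  assumes "n \<ge> 6" and "linking_matrix n \<Lambda>"
  shows "real (abelian_rank (milnor_quotient n \<Lambda>))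
           \<ge> (real n ^ 3 - 9 * real n ^ 2 + 20 * real n - 6) / 6"
proof -
  let ?v = "\<lambda>(j, k). coords (milnor_vec n \<Lambda> j k)"
  let ?H = "{milnor_vec n \<Lambda> j k | j k. j \<in> {1..n} \<and> k \<in> {1..n} \<and> j \<noteq> k}"
  obtain E where E: "E \<subseteq> off_diagonal n" "card E = 2 * n - 1"
    "\<And>j k. j \<in> {1..n} \<Longrightarrow> k \<in> {1..n} \<Longrightarrow> coords (milnor_vec n \<Lambda> j k) \<in> milnor_span n \<Lambda> (off_diagonal n - E)"
  proof (cases "\<exists>k\<in>{1..n}. \<forall>i\<in>{1..n}. \<Lambda> i k = 0")
    case True
    then obtain i0 where "i0 \<in> {1..n}" "\<And>i. i \<in> {1..n} \<Longrightarrow> \<Lambda> i i0 = 0" by blast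
    from redundant_generators_isolated[OF assms(2) _ this that] assms(1) show thesis by simp
  next
    case False
    then have "\<And>k. k \<in> {1..n} \<Longrightarrow> \<exists>i\<in>{1..n}. \<Lambda> i k \<noteq> 0" by blast
    from redundant_generators_no_isolated[OF assms(2) _ this that] assms(1) show thesis by simp
  qed
  have finP: "finite (off_diagonal n)" by (rule finite_subset[of _ "{1..n} \<times> {1..n}"]) auto
  have "card (triples n) \<le> abelian_rank (milnor_quotient n \<Lambda>) + card (?v ` (off_diagonal n - E))"
    unfolding milnor_quotient_def milnor_subgroup_def ext3_def
  proof (rule abelian_rank_quotient_ge)
    show "?H \<subseteq> carrier (free_Abelian_group (triples n))"
      using milnor_vec_closed unfolding ext3_def by blast
    show "coords ` ?H \<subseteq> milnor_span n \<Lambda> (off_diagonal n - E)"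
      using E(3) by blast
  qed (use finP finite_triples in auto)
  also have "card (?v ` (off_diagonal n - E)) \<le> card (off_diagonal n - E)"
    using finP by (intro card_image_le) simp
  also have "card (off_diagonal n - E) = n * (n - 1) - (2 * n - 1)"
    using E(1,2) finP card_off_diagonal[of n] by (simp add: card_Diff_subset finite_subset)
  finally have "real (card (triples n)) \<le> real (abelian_rank (milnor_quotient n \<Lambda>)) + real (n * (n - 1) - (2 * n - 1))"
    by linarith
  moreover have "real (n * (n - 1) - (2 * n - 1)) = real n ^ 2 - 3 * real n + 1"
  proof -
    have "2 * n - 1 \<le> n * (n - 1)"
    proof -
      have "2 * n - 1 \<le> n * 2" by simp
      also have "\<dots> \<le> n * (n - 1)" using assms(1) by (intro mult_le_mono) auto
      finally show ?thesis .
    qed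
    then show ?thesis using assms(1) by (simp add: of_nat_diff power2_eq_square algebra_simps)
  qed
  ultimately show ?thesis by (simp add: card_triples field_simps)
qed

end
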